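(* Let $(X,d)$ be a complete metric space and let $f\colon X\to[-\infty,+\infty]$ be a KL-function that is bounded below and continuous on slope-bounded sets. Let $\alpha,\beta>0$. Then any relatively compact sequence $(x_k)_{k\ge0}$ in $X$ satisfying, for all $k\ge0$, the slope-descent conditions $$f(x_k)-f(x_{k+1})\ \ge\ \alpha\, d^2(x_k,x_{k+1})\qquad\text{and}\qquad d(x_k,x_{k+1})\ \ge\ \beta\,|\overline{\nabla} f|(x_{k+1})$$ converges to a critical point of $f$.
   Context: Let $(X,d)$ be a metric space and $f\colon X\to[-\infty,+\infty]$. The function $f$ is proper if it never takes the value $-\infty$ and its domain $\mathrm{dom}\,f=\{x: f(x)<+\infty\}$ is nonempty. Slope: at a point $x$ with $f(x)$ finite, $|\nabla f|(x)$ is the infimum of those $\epsilon>0$ for which $x$ is a local minimizer of $y\mapsto f(y)+\epsilon\, d(x,y)$ (with $\inf\emptyset=+\infty$); if $f(x)=+\infty$ then $|\nabla f|(x)=+\infty$. Limiting slope: for $\bar x\in\mathrm{dom}\,f$, $|\overline{\nabla} f|(\bar x)=\liminf_{x\to\bar x,\ f(x)\to f(\bar x)}|\nabla f|(x)$ (points $x=\bar x$ allowed), i.e. $\lim_{r\downarrow0}\inf\{|\nabla f|(x): d(x,\bar x)<r,\ |f(x)-f(\bar x)|<r\}$; it is taken to be $+\infty$ where $f=+\infty$. A point $x^*$ is critical for $f$ if $|\overline{\nabla} f|(x^* )=0$. A desingularizer is a continuous function $\phi\colon[0,\infty)\to[0,\infty)$ with $\phi(0)=0$ that has a continuous, strictly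 positive derivative on $(0,+\infty)$ (with the conventions $\phi(+\infty)=+\infty$ and $\phi(t)=0$ for $t<0$). A lower semicontinuous proper function $f\colon X\to[-\infty,+\infty]$ is a KL-function if for every $\bar x\in X$ with $\bar f:=f(\bar x)$ finite there exist a concave desingularizer $\phi$ and $\rho>0$ such that, for all $x\in X$, $d(x,\bar x)<\rho$ and $0<f(x)-\bar f<\rho$ imply $|\nabla(\phi\circ(f-\bar f))|(x)\ge1$. A proper function $f$ is continuous on slope-bounded sets if for every $\bar x\in\mathrm{dom}\,f$ and every sequence $x_k\to\bar x$ such that the values $f(x_k)$ and the slopes $|\nabla f|(x_k)$ are uniformly bounded, one has $f(x_k)\to f(\bar x)$. *)

theory Defs
  imports "HOL-Analysis.Analysis"
begin

definition edom :: "('a \<Rightarrow> ereal) \<Rightarrow> 'a set" where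
  "edom f = {x. f x < \<infinity>}"

definition proper_fun :: "('a \<Rightarrow> ereal) \<Rightarrow> bool" where
  "proper_fun f \<longleftrightarrow> (\<forall>x. f x \<noteq> -\<infinity>) \<and> edom f \<noteq> {}"

definition lower_semicontinuous :: "('a::topological_space \<Rightarrow> ereal) \<Rightarrow> bool" where
  "lower_semicontinuous f \<longleftrightarrow> (\<forall>x. f x \<le> Liminf (at x) f)"

definition fun_bounded_below :: "('a \<Rightarrow> ereal) \<Rightarrow> bool" where
  "fun_bounded_below f \<longleftrightarrow> (\<exists>m::real. \<forall>x. ereal m \<le> f x)"

definition local_minimizer :: "('a::topological_space \<Rightarrow> ereal) \<Rightarrow> 'a \<Rightarrow> bool" where
  "local_minimizer g x \<longleftrightarrow> (\<forall>\<^sub>F y in nhds x. g x \<le> g y)"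

text \<open>The infimum is taken in the extended reals, so it is \<open>\<infinity>\<close> for the empty set. The slope is
  only meaningful where \<open>f\<close> does not take the value \<open>-\<infinity>\<close>.\<close>

definition slope :: "('a::metric_space \<Rightarrow> ereal) \<Rightarrow> 'a \<Rightarrow> ereal" where
  "slope f x = (if f x = \<infinity> then \<infinity>
     else Inf (ereal ` {\<epsilon>. 0 < \<epsilon> \<and> local_minimizer (\<lambda>y. f y + ereal (\<epsilon> * dist x y)) x}))"

text \<open>The filter expressing \<open>x \<rightarrow> xbar\<close> and \<open>f x \<rightarrow> f xbar\<close>, with \<open>x = xbar\<close> allowed.\<close>

definition value_nhds :: "('a::metric_space \<Rightarrow> ereal) \<Rightarrow> 'a \<Rightarrow> 'a filter" where
  "value_nhds f xbar = inf (nhds xbar) (filtercomap f (nhds (f xbar)))"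

definition limiting_slope :: "('a::metric_space \<Rightarrow> ereal) \<Rightarrow> 'a \<Rightarrow> ereal" where
  "limiting_slope f xbar = (if f xbar = \<infinity> then \<infinity> else Liminf (value_nhds f xbar) (slope f))"

definition critical_point :: "('a::metric_space \<Rightarrow> ereal) \<Rightarrow> 'a \<Rightarrow> bool" where
  "critical_point f x \<longleftrightarrow> limiting_slope f x = 0"

text \<open>A desingularizer is represented by a total real function of which only the restriction to
  \<open>[0,\<infinity>)\<close> matters.\<close>

definition desingularizer :: "(real \<Rightarrow> real) \<Rightarrow> bool" where
  "desingularizer \<phi> \<longleftrightarrow>
     \<phi> ` {0..} \<subseteq> {0..} \<and> continuous_on {0..} \<phi> \<and> \<phi> 0 = 0 \<and>
     (\<exists>\<phi>'. continuous_on {0<..} \<phi>' \<and>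
        (\<forall>t>0. (\<phi> has_real_derivative \<phi>' t) (at t) \<and> 0 < \<phi>' t))"

text \<open>The conventions \<open>\<phi> (+\<infinity>) = +\<infinity>\<close> and \<open>\<phi> t = 0\<close> for \<open>t < 0\<close>.\<close>

definition extend_desing :: "(real \<Rightarrow> real) \<Rightarrow> ereal \<Rightarrow> ereal" where
  "extend_desing \<phi> t =
     (if t = \<infinity> then \<infinity> else if t < 0 then 0 else ereal (\<phi> (real_of_ereal t)))"

definition KL_function :: "('a::metric_space \<Rightarrow> ereal) \<Rightarrow> bool" where
  "KL_function f \<longleftrightarrow> lower_semicontinuous f \<and> proper_fun f \<and>
     (\<forall>xbar. \<bar>f xbar\<bar> \<noteq> \<infinity> \<longrightarrow>
        (\<exists>\<phi> \<rho>. desingularizer \<phi> \<and> concave_on {0..} \<phi> \<and> 0 < (\<rho>::real) \<and>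
           (\<forall>x. dist x xbar < \<rho> \<and> 0 < f x - f xbar \<and> f x - f xbar < ereal \<rho> \<longrightarrow>
              1 \<le> slope (\<lambda>y. extend_desing \<phi> (f y - f xbar)) x)))"

definition continuous_on_slope_bounded :: "('a::metric_space \<Rightarrow> ereal) \<Rightarrow> bool" where
  "continuous_on_slope_bounded f \<longleftrightarrow> proper_fun f \<and>
     (\<forall>xbar\<in>edom f. \<forall>u. u \<longlonglongrightarrow> xbar \<and>
        (\<exists>C::real. \<forall>k. \<bar>f (u k)\<bar> \<le> ereal C \<and> slope f (u k) \<le> ereal C) \<longrightarrow>
        (\<lambda>k. f (u k)) \<longlonglongrightarrow> f xbar)"

definition relatively_compact_seq :: "(nat \<Rightarrow> 'a::metric_space) \<Rightarrow> bool" where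
  "relatively_compact_seq u \<longleftrightarrow> compact (closure (range u))"

text \<open>Sanity check: the lower limit along the filter agrees with the explicit formula
  \<open>lim_{r \<down> 0} inf {slope f x | d(x, xbar) < r, |f x - f xbar| < r}\<close>.\<close>

lemma eventually_value_nhds:
  fixes f :: "'a::metric_space \<Rightarrow> ereal"
  assumes "\<bar>f xbar\<bar> \<noteq> \<infinity>"
  shows "eventually P (value_nhds f xbar) \<longleftrightarrow>
    (\<exists>r>0. \<forall>x. dist x xbar < r \<and> \<bar>f x - f xbar\<bar> < ereal r \<longrightarrow> P x)" (is "?L \<longleftrightarrow> ?R")
proof -
  obtain a where a: "f xbar = ereal a" using assms by (cases "f xbar") auto
  have dab: "\<bar>ereal b - ereal a\<bar> < ereal r \<longleftrightarrow> dist b a < r" for b r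
    by (simp add: dist_real_def)
  have ev: "eventually Q (nhds (ereal a)) \<longleftrightarrow> (\<exists>r>0. \<forall>b. dist b a < r \<longrightarrow> Q (ereal b))" for Q
    by (simp add: nhds_ereal eventually_filtermap eventually_nhds_metric)
  show ?thesis
  proof
    assume ?L
    then obtain A B where A: "eventually A (nhds xbar)" and B: "eventually B (filtercomap f (nhds (f xbar)))"
      and AB: "\<And>x. A x \<and> B x \<Longrightarrow> P x"
      unfolding value_nhds_def eventually_inf by blast
    obtain Q where Q: "eventually Q (nhds (ereal a))" and QB: "\<And>x. Q (f x) \<Longrightarrow> B x"
      using B unfolding a eventually_filtercomap by blast
    obtain r where r: "r > 0" "\<And>x. dist x xbar < r \<Longrightarrow> A x"
      using A unfolding eventually_nhds_metric by blast
    obtain s where s: "s > 0" "\<And>b. dist b a < s \<Longrightarrow> Q (ereal b)"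
      using Q unfolding ev by blast
    show ?R
    proof (intro exI[of _ "min r s"] conjI allI impI)
      show "0 < min r s" using r s by simp
      fix x assume x: "dist x xbar < min r s \<and> \<bar>f x - f xbar\<bar> < ereal (min r s)"
      then obtain b where b: "f x = ereal b" unfolding a by (cases "f x") auto
      then have "dist b a < min r s" using x dab unfolding a b by blast
      then show "P x" using AB r(2) s(2) QB x b by (metis min_less_iff_conj)
    qed
  next
    assume ?R
    then obtain r where r: "r > 0"
      and P: "\<And>x. dist x xbar < r \<and> \<bar>f x - f xbar\<bar> < ereal r \<Longrightarrow> P x" by blast
    have "eventually (\<lambda>x. dist x xbar < r) (nhds xbar)"
      using r eventually_nhds_metric by blast
    moreover have "eventually (\<lambda>x. \<bar>f x - f xbar\<bar> < ereal r) (filtercomap f (nhds (f xbar)))"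
    proof -
      have "eventually (\<lambda>t. \<bar>t - ereal a\<bar> < ereal r) (nhds (ereal a))"
        unfolding ev dab using r by blast
      then show ?thesis unfolding a eventually_filtercomap by blast
    qed
    ultimately show ?L unfolding value_nhds_def eventually_inf using P by blast
  qed
qed

lemma limiting_slope_explicit:
  fixes f :: "'a::metric_space \<Rightarrow> ereal"
  assumes fin: "\<bar>f xbar\<bar> \<noteq> \<infinity>"
  shows "((\<lambda>r. INF x\<in>{x. dist x xbar < r \<and> \<bar>f x - f xbar\<bar> < ereal r}. slope f x)
           \<longlongrightarrow> limiting_slope f xbar) (at_right (0::real))"
proof -
  define S where "S r = {x. dist x xbar < r \<and> \<bar>f x - f xbar\<bar> < ereal r}" for r
  define m where "m r = (INF x\<in>S r. slope f x)" for r
  have S_mono: "r \<le> s \<Longrightarrow> S r \<subseteq> S s" for r s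
    unfolding S_def using order_less_le_trans by fastforce
  have L: "limiting_slope f xbar = Liminf (value_nhds f xbar) (slope f)"
    using fin by (auto simp: limiting_slope_def)
  have "(m \<longlongrightarrow> limiting_slope f xbar) (at_right 0)"
  proof (rule order_tendstoI)
    fix c assume "c < limiting_slope f xbar"
    then obtain d where d: "c < d" "d < limiting_slope f xbar" using dense by blast
    then have "eventually (\<lambda>x. d < slope f x) (value_nhds f xbar)"
      unfolding L by (metis less_LiminfD)
    then obtain r where r: "r > 0" "\<And>x. x \<in> S r \<Longrightarrow> d < slope f x"
      unfolding eventually_value_nhds[of f, OF fin] S_def by blast
    have "c < m s" if "0 < s" "s < r" for s
    proof -
      have "d \<le> m s" unfolding m_def
        using r(2) S_mono[of s r] that by (intro INF_greatest) (meson less_imp_le subsetD)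
      then show ?thesis using d by simp
    qed
    then show "eventually (\<lambda>s. c < m s) (at_right 0)"
      unfolding eventually_at_right_field using r(1) by blast
  next
    fix c assume c: "limiting_slope f xbar < c"
    have "m s \<le> limiting_slope f xbar" if "0 < s" for s
    proof -
      have "eventually (\<lambda>x. x \<in> S s) (value_nhds f xbar)"
        unfolding eventually_value_nhds[of f, OF fin] S_def using that by blast
      then have "eventually (\<lambda>x. m s \<le> slope f x) (value_nhds f xbar)"
        by eventually_elim (simp add: m_def INF_lower)
      then show ?thesis unfolding L by (rule Liminf_bounded)
    qed
    then show "eventually (\<lambda>s. m s < c) (at_right 0)"
      unfolding eventually_at_right_field using c by (intro exI[of _ 1]) (auto intro: le_less_trans)
  qed
  then show ?thesis unfolding m_def S_def .
qed

end

theory Submission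
  imports Defs
begin

text \<open>Along the sequence \<open>f\<close> decreases to a limit \<open>L\<close>, so the step lengths \<open>d k\<close>, and with them the
  limiting slopes, tend to \<open>0\<close>. Replacing each iterate by a nearby point of small slope, lower
  semicontinuity and continuity on slope-bounded sets show that every limit point \<open>p\<close> is critical
  with \<open>f p = L\<close>. Near \<open>p\<close> the KL inequality passes through the chain rule to
  \<open>\<phi>' (f x - L) * limiting_slope f x \<ge> 1\<close>; with concavity of \<open>\<phi>\<close> and the descent conditions this yields
  \<open>(d (k + 1))\<^sup>2 \<le> d k * M * (h k - h (k + 1))\<close> for \<open>h k = \<phi> (f (x (k + 1)) - L)\<close> and
  \<open>M = 1 / (\<alpha> \<beta>)\<close>. By AM-GM the total remaining length is at most \<open>d n + M * h n\<close>, so an iterate close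
  enough to \<open>p\<close> traps all later ones in any prescribed ball around \<open>p\<close>.\<close>

section \<open>Slopes as thresholds for local minimality\<close>

lemma slope_nonneg: "0 \<le> slope f x"
  unfolding slope_def by (auto intro!: Inf_greatest)

lemma limiting_slope_nonneg: "0 \<le> limiting_slope f x"
  unfolding limiting_slope_def by (auto intro!: Liminf_bounded always_eventually slope_nonneg)

text \<open>The penalties that make \<open>x\<close> a local minimizer form an upward closed set,
  because distances are nonnegative; so every \<open>e\<close> above the infimum is itself
  admissible.\<close>

lemma slope_lessD:
  assumes "slope f x < ereal e"
  shows "0 < e" "\<forall>\<^sub>F y in nhds x. f x \<le> f y + ereal (e * dist x y)"
proof -
  have "Inf (ereal ` {\<epsilon>. 0 < \<epsilon> \<and> local_minimizer (\<lambda>y. f y + ereal (\<epsilon> * dist x y)) x}) < ereal e"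
    using assms by (auto simp: slope_def split: if_splits)
  then obtain d where d: "0 < d" "d < e" "local_minimizer (\<lambda>y. f y + ereal (d * dist x y)) x"
    unfolding Inf_less_iff by auto
  show "0 < e" using d by simp
  have "\<forall>\<^sub>F y in nhds x. f x + ereal (d * dist x x) \<le> f y + ereal (d * dist x y)"
    using d(3) unfolding local_minimizer_def .
  then show "\<forall>\<^sub>F y in nhds x. f x \<le> f y + ereal (e * dist x y)"
  proof eventually_elim
    case (elim y)
    have "f x \<le> f y + ereal (d * dist x y)" using elim by (simp flip: zero_ereal_def)
    also have "\<dots> \<le> f y + ereal (e * dist x y)"
      using d by (intro add_left_mono) (simp add: mult_right_mono)
    finally show ?case .
  qed
qed

lemma slope_le:
  assumes "0 < c" "\<forall>\<^sub>F y in nhds x. f x \<le> f y + ereal (c * dist x y)"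
  shows "f x = \<infinity> \<or> slope f x \<le> ereal c"
  using assms unfolding slope_def local_minimizer_def
  by (auto intro!: Inf_lower simp flip: zero_ereal_def)

section \<open>Desingularizers and the chain rule\<close>

lemma desingularizer_mono:
  assumes "desingularizer \<phi>" "0 \<le> s" "s \<le> t"
  shows "\<phi> s \<le> \<phi> t"
proof (cases "s = t")
  case False
  obtain \<phi>' where \<phi>': "\<And>t. t > 0 \<Longrightarrow> (\<phi> has_real_derivative \<phi>' t) (at t) \<and> 0 < \<phi>' t"
    using assms(1) unfolding desingularizer_def by blast
  have "continuous_on {0..} \<phi>" using assms(1) unfolding desingularizer_def by blast
  then have cont: "continuous_on {s..t} \<phi>" by (rule continuous_on_subset) (use assms(2) in auto)
  have "\<exists>D. (\<phi> has_real_derivative D) (at w) \<and> 0 < D" if "s < w" "w < t" for w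
    using \<phi>'[of w] assms(2) that by (intro exI[of _ "\<phi>' w"]) simp
  moreover have "s < t" using False assms(3) by simp
  ultimately have "\<phi> s < \<phi> t" by (intro DERIV_pos_imp_increasing_open[OF _ _ cont])
  then show ?thesis by simp
qed simp

text \<open>The half of the chain rule that bounds the composed slope from above. Near
  \<open>x\<close> the value of \<open>f\<close> drops by at most \<open>e * dist x y\<close>;
  \<open>\<phi>\<close> is monotone and to first order drops by \<open>D\<close> times that, and
  \<open>D * e < c\<close> absorbs the error.\<close>

lemma slope_desingularized_le:
  fixes f :: "'a::metric_space \<Rightarrow> ereal"
  assumes \<phi>: "desingularizer \<phi>" and D: "(\<phi> has_real_derivative D) (at s)"
    and s: "0 < s" and fx: "f x = ereal (a + s)"
    and e: "slope f x < ereal e" and c: "D * e < c" "0 < c"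
  shows "slope (\<lambda>y. extend_desing \<phi> (f y - ereal a)) x \<le> ereal c"
proof -
  define F where "F y = extend_desing \<phi> (f y - ereal a)" for y
  note e0 = slope_lessD(1)[OF e] and ev = slope_lessD(2)[OF e]
  have Fx: "F x = ereal (\<phi> s)" using s by (simp add: F_def fx extend_desing_def)
  have \<phi>0: "0 \<le> \<phi> t" if "0 \<le> t" for t using \<phi> that unfolding desingularizer_def by auto
  \<comment> \<open>This function has positive derivative at \<open>s\<close>, so it is smaller just
    to the left of \<open>s\<close>; rearranged, \<open>\<phi>\<close> drops over a short length
    \<open>h\<close> by at most \<open>c * h / e\<close>.\<close>
  have "((\<lambda>t. c * t / e - \<phi> t) has_real_derivative (c / e - D)) (at s)"
    using e0 by (auto intro!: derivative_eq_intros D)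
  moreover have "0 < c / e - D" using c e0 by (simp add: field_simps)
  ultimately obtain \<delta> where \<delta>: "0 < \<delta>"
    "\<And>h. 0 < h \<Longrightarrow> h < \<delta> \<Longrightarrow> c * (s - h) / e - \<phi> (s - h) < c * s / e - \<phi> s"
    using DERIV_pos_inc_left by blast
  have \<delta>': "\<phi> s \<le> \<phi> (s - h) + c * h / e" if "0 \<le> h" "h < \<delta>" for h
  proof (cases "h = 0")
    case False
    then show ?thesis using \<delta>(2)[of h] that by (simp add: algebra_simps diff_divide_distrib)
  qed simp
  \<comment> \<open>With this radius \<open>h = e * dist x y\<close> is below
    \<open>\<delta>\<close>, for the linear bound, and below \<open>s\<close>, so that
    \<open>s - h\<close> stays positive and the negative branch of \<open>extend_desing\<close> is
    avoided.\<close>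
  have "\<forall>\<^sub>F y in nhds x. dist y x < min \<delta> s / e"
    unfolding eventually_nhds_metric using \<delta>(1) s e0 by (intro exI[of _ "min \<delta> s / e"]) auto
  with ev have "\<forall>\<^sub>F y in nhds x. F x \<le> F y + ereal (c * dist x y)"
  proof eventually_elim
    case (elim y)
    define h where "h = e * dist x y"
    have h: "0 \<le> h" "h < \<delta>" "h < s"
      using elim(2) e0 by (auto simp: h_def dist_commute field_simps)
    have ch: "c * h / e = c * dist x y" using e0 by (simp add: h_def)
    show ?case
    proof (cases "f y")
      case (real b)
      then have b: "s - h \<le> b - a" using elim(1) by (simp add: fx h_def)
      have "\<phi> (s - h) \<le> \<phi> (b - a)" using desingularizer_mono[OF \<phi> _ b] h by simp
      then have "\<phi> s \<le> \<phi> (b - a) + c * dist x y" using \<delta>'[OF h(1,2)] ch by simp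
      moreover have "F y = ereal (\<phi> (b - a))"
        using b h by (simp add: F_def extend_desing_def real)
      ultimately show ?thesis by (simp add: Fx)
    next
      case PInf
      then show ?thesis by (simp add: F_def extend_desing_def)
    next
      case MInf
      then show ?thesis using elim(1) by (simp add: fx)
    qed
  qed
  then show ?thesis using slope_le[OF c(2), of F x] Fx unfolding F_def by auto
qed

section \<open>The KL inequality for limiting slopes\<close>

lemma limiting_slope_approx:
  fixes f :: "'a::metric_space \<Rightarrow> ereal"
  assumes fx: "\<bar>f x\<bar> \<noteq> \<infinity>" and l: "limiting_slope f x < l"
    and ev: "eventually P (value_nhds f x)"
  shows "\<exists>y. P y \<and> slope f y < l"
proof (rule ccontr)
  assume "\<not> ?thesis"
  then have "\<forall>\<^sub>F y in value_nhds f x. l \<le> slope f y"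
    using ev by (auto elim!: eventually_mono simp: not_less)
  then have "l \<le> Liminf (value_nhds f x) (slope f)" by (rule Liminf_bounded)
  then show False using l fx by (auto simp: limiting_slope_def)
qed

text \<open>If \<open>\<phi>' s * l < 1\<close>, some \<open>y\<close> near \<open>x\<close> in
  position and value has slope so small that the chain rule pushes the slope of the composition at
  \<open>y\<close> below 1, against the KL inequality there. The KL region is given by strict
  inequalities, so \<open>y\<close> still lies in it.\<close>

lemma KL_limiting_slope:
  fixes f :: "'a::metric_space \<Rightarrow> ereal"
  assumes \<phi>: "desingularizer \<phi>"
    and cont: "continuous_on {0<..} \<phi>'"
    and D: "\<And>t. t > 0 \<Longrightarrow> (\<phi> has_real_derivative \<phi>' t) (at t)"
    and KL: "\<And>y. dist y p < \<rho> \<Longrightarrow> 0 < f y - ereal a \<Longrightarrow> f y - ereal a < ereal \<rho> \<Longrightarrow>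
          1 \<le> slope (\<lambda>z. extend_desing \<phi> (f z - ereal a)) y"
    and x: "dist x p < \<rho>" "f x = ereal (a + s)" "0 < s" "s < \<rho>"
    and l: "limiting_slope f x \<le> ereal l"
  shows "1 \<le> \<phi>' s * l"
proof (rule ccontr)
  assume "\<not> 1 \<le> \<phi>' s * l"
  moreover have "((\<lambda>l. \<phi>' s * l) \<longlongrightarrow> \<phi>' s * l) (at_right l)" by (intro tendsto_intros)
  ultimately have "\<forall>\<^sub>F l' in at_right l. \<phi>' s * l' < 1" by (intro order_tendstoD) auto
  \<comment> \<open>The room above \<open>l\<close> is needed because the nearby slopes come close
    to the limiting slope but may exceed it.\<close>
  then obtain l' where l': "l < l'" "\<phi>' s * l' < 1"
    using eventually_happens'[OF trivial_limit_at_right_real eventually_conj[OF _ eventually_at_right_less]] by blast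
  have "isCont \<phi>' s" using cont x(3) by (simp add: continuous_on_eq_continuous_at)
  then have "((\<lambda>t. \<phi>' t * l') \<longlongrightarrow> \<phi>' s * l') (nhds s)"
    by (intro tendsto_intros) (simp add: isCont_def tendsto_at_iff_tendsto_nhds)
  then have "\<forall>\<^sub>F t in nhds s. \<phi>' t * l' < 1" using l'(2) by (rule order_tendstoD)
  moreover have "\<forall>\<^sub>F t in nhds s. t \<in> {0<..<\<rho>}"
    using x by (intro eventually_nhds_in_open) auto
  ultimately have "\<forall>\<^sub>F t in nhds s. \<phi>' t * l' < 1 \<and> 0 < t \<and> t < \<rho>"
    by eventually_elim auto
  then obtain r where r: "0 < r" "\<And>t. dist t s < r \<Longrightarrow> \<phi>' t * l' < 1 \<and> 0 < t \<and> t < \<rho>"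
    unfolding eventually_nhds_metric by blast
  have fin: "\<bar>f x\<bar> \<noteq> \<infinity>" by (simp add: x)
  \<comment> \<open>The first bound keeps the gap \<open>t\<close> at \<open>y\<close> close to
    \<open>s\<close>; the second keeps \<open>y\<close> in the \<open>\<rho>\<close>-ball around
    \<open>p\<close>.\<close>
  let ?r = "min r (\<rho> - dist x p)"
  have ev: "eventually (\<lambda>y. dist y x < ?r \<and> \<bar>f y - f x\<bar> < ereal ?r) (value_nhds f x)"
    unfolding eventually_value_nhds[of f, OF fin] using r(1) x(1) by (intro exI[of _ ?r]) auto
  then obtain y where y: "dist y x < ?r" "\<bar>f y - f x\<bar> < ereal ?r" "slope f y < ereal l'"
  proof -
    have "limiting_slope f x < ereal l'" using l by (rule le_less_trans) (simp add: l'(1))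
    from limiting_slope_approx[OF fin this ev] show ?thesis using that by blast
  qed
  obtain b where b: "f y = ereal b" using y(2) x(2) by (cases "f y") auto
  define t where "t = b - a"
  have t: "\<phi>' t * l' < 1" "0 < t" "t < \<rho>"
    using r(2)[of t] y(2) by (auto simp: b x(2) t_def dist_real_def algebra_simps)
  have yp: "dist y p < \<rho>" using y(1) dist_triangle[of y p x] by simp
  obtain c where c: "max 0 (\<phi>' t * l') < c" "c < 1"
    using dense[of "max 0 (\<phi>' t * l')" 1] t(1) by auto
  have "slope (\<lambda>z. extend_desing \<phi> (f z - ereal a)) y \<le> ereal c"
    using c t(2) b y(3) by (intro slope_desingularized_le[OF \<phi> D[OF t(2)]]) (auto simp: t_def)
  moreover have "1 \<le> slope (\<lambda>z. extend_desing \<phi> (f z - ereal a)) y"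
    using t yp by (intro KL) (auto simp: b t_def)
  ultimately have "1 \<le> ereal c" by (rule order_trans[rotated])
  then show False using c(2) by simp
qed

section \<open>Limit points and criticality\<close>

lemma lower_semicontinuous_sequentially:
  assumes lsc: "lower_semicontinuous f" and y: "y \<longlonglongrightarrow> p" and L: "(\<lambda>k. f (y k)) \<longlonglongrightarrow> L"
  shows "f p \<le> L"
proof (rule ccontr)
  assume "\<not> f p \<le> L"
  then obtain c where c: "L < c" "c < f p" using dense not_le by metis
  then have "c < Liminf (at p) f" using lsc unfolding lower_semicontinuous_def by (meson less_le_trans)
  then have "\<forall>\<^sub>F z in at p. c < f z" by (rule less_LiminfD)
  \<comment> \<open>\<open>Liminf (at p) f\<close> ignores \<open>p\<close> itself, which the
    sequence may hit; there the bound holds by the choice of \<open>c\<close>.\<close>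
  then have "\<forall>\<^sub>F z in nhds p. c < f z"
    unfolding eventually_at_filter by eventually_elim (use c in auto)
  then have "\<forall>\<^sub>F k in sequentially. c < f (y k)"
    using y by (rule eventually_compose_filterlim)
  moreover have "\<forall>\<^sub>F k in sequentially. f (y k) < c" using L c(1) by (rule order_tendstoD)
  ultimately have "\<forall>\<^sub>F k::nat in sequentially. False" by eventually_elim auto
  then show False by simp
qed

lemma tendsto_dist_le:
  assumes v: "(v \<longlongrightarrow> p) F" and \<delta>: "(\<delta> \<longlongrightarrow> 0) F" and le: "\<And>k. dist (y k) (v k) \<le> \<delta> k"
  shows "(y \<longlongrightarrow> p) F"
proof -
  have upper: "((\<lambda>k. \<delta> k + dist (v k) p) \<longlongrightarrow> 0) F"
    using tendsto_add[OF \<delta> tendsto_dist_iff[THEN iffD1, OF v]] by simp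
  have "dist (y k) p \<le> \<delta> k + dist (v k) p" for k
    using le[of k] dist_triangle[of "y k" p "v k"] by simp
  then have "((\<lambda>k. dist (y k) p) \<longlongrightarrow> 0) F"
    by (intro tendsto_sandwich[OF _ _ tendsto_const upper] always_eventually allI) simp_all
  then show ?thesis by (rule tendsto_dist_iff[THEN iffD2])
qed

text \<open>The continuity hypothesis speaks of slopes, but only limiting slopes are controlled. So
  each \<open>v k\<close> is traded for a \<open>y k\<close> within \<open>\<delta> k\<close> in
  position and value whose slope is below \<open>b k + \<delta> k\<close>.\<close>

lemma critical_limit_point:
  fixes f :: "'a::metric_space \<Rightarrow> ereal"
  assumes lsc: "lower_semicontinuous f" and cont: "continuous_on_slope_bounded f"
    and v: "v \<longlonglongrightarrow> p" and fv: "\<And>k. f (v k) = ereal (g k)" and g: "g \<longlonglongrightarrow> L"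
    and b: "\<And>k. limiting_slope f (v k) \<le> ereal (b k)" "b \<longlonglongrightarrow> 0"
  shows "f p = ereal L" "critical_point f p"
proof -
  define \<delta> where "\<delta> k = inverse (real (Suc k))" for k
  have \<delta>: "\<delta> \<longlonglongrightarrow> 0" unfolding \<delta>_def by (rule LIMSEQ_inverse_real_of_nat)
  have \<delta>0: "0 < \<delta> k" for k by (simp add: \<delta>_def)
  have "\<exists>y. (dist y (v k) < \<delta> k \<and> \<bar>f y - f (v k)\<bar> < ereal (\<delta> k)) \<and> slope f y < ereal (b k + \<delta> k)" for k
  proof (rule limiting_slope_approx)
    show fin: "\<bar>f (v k)\<bar> \<noteq> \<infinity>" by (simp add: fv)
    show "limiting_slope f (v k) < ereal (b k + \<delta> k)"
      using b(1)[of k] by (rule le_less_trans) (simp add: \<delta>0)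
    show "\<forall>\<^sub>F y in value_nhds f (v k). dist y (v k) < \<delta> k \<and> \<bar>f y - f (v k)\<bar> < ereal (\<delta> k)"
      unfolding eventually_value_nhds[of f, OF fin] using \<delta>0 by blast
  qed
  then obtain y where y: "\<And>k. dist (y k) (v k) < \<delta> k" "\<And>k. \<bar>f (y k) - f (v k)\<bar> < ereal (\<delta> k)"
    "\<And>k. slope f (y k) < ereal (b k + \<delta> k)" by metis
  have "\<exists>h. f (y k) = ereal h" for k using y(2)[of k] fv[of k] by (cases "f (y k)") auto
  then obtain h where h: "\<And>k. f (y k) = ereal (h k)" by metis
  have "y \<longlonglongrightarrow> p"
    using y(1) by (intro tendsto_dist_le[OF v \<delta>]) (simp add: less_imp_le)
  have hL: "h \<longlonglongrightarrow> L"
    using y(2) by (intro tendsto_dist_le[OF g \<delta>]) (simp add: less_imp_le h fv dist_real_def)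
  then have fL: "(\<lambda>k. f (y k)) \<longlonglongrightarrow> ereal L" by (simp add: h)
  have b\<delta>: "(\<lambda>k. b k + \<delta> k) \<longlonglongrightarrow> 0" using tendsto_add[OF b(2) \<delta>] by simp
  obtain C1 where C1: "\<And>k. \<bar>h k\<bar> \<le> C1"
    using hL by (metis convergentI convergent_imp_Bseq BseqE real_norm_def)
  obtain C2 where C2: "\<And>k. \<bar>b k + \<delta> k\<bar> \<le> C2"
    using b\<delta> by (metis convergentI convergent_imp_Bseq BseqE real_norm_def)
  have "\<bar>f (y k)\<bar> \<le> ereal (max C1 C2) \<and> slope f (y k) \<le> ereal (max C1 C2)" for k
  proof
    show "\<bar>f (y k)\<bar> \<le> ereal (max C1 C2)" using C1[of k] by (simp add: h le_max_iff_disj del: ereal_max)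
    have "ereal (b k + \<delta> k) \<le> ereal (max C1 C2)"
      using C2[of k] by (simp add: le_max_iff_disj abs_le_iff del: ereal_max)
    then show "slope f (y k) \<le> ereal (max C1 C2)" using y(3)[of k] by (meson less_imp_le order_trans)
  qed
  \<comment> \<open>Lower semicontinuity gives \<open>f p\<close> a finite upper bound, as the
    continuity hypothesis asks of its base point.\<close>
  moreover have "p \<in> edom f"
    using lower_semicontinuous_sequentially[OF lsc \<open>y \<longlonglongrightarrow> p\<close> fL] unfolding edom_def by auto
  ultimately have fp: "(\<lambda>k. f (y k)) \<longlonglongrightarrow> f p"
    using cont \<open>y \<longlonglongrightarrow> p\<close> unfolding continuous_on_slope_bounded_def by blast
  then show L: "f p = ereal L" using fL LIMSEQ_unique by blast
  \<comment> \<open>The values now converge to \<open>f p\<close> too, so \<open>y\<close> runs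
    along \<open>value_nhds f p\<close> and its vanishing slopes bound the limiting slope at
    \<open>p\<close>.\<close>
  have lim: "filterlim y (value_nhds f p) sequentially"
    unfolding value_nhds_def filterlim_inf filterlim_filtercomap_iff
    using \<open>y \<longlonglongrightarrow> p\<close> fp by (simp add: o_def)
  have "Liminf (value_nhds f p) (slope f) \<le> 0"
  proof (rule ccontr)
    assume "\<not> ?thesis"
    then obtain c where c: "0 < c" "c < Liminf (value_nhds f p) (slope f)"
      using dense not_le by metis
    have "\<forall>\<^sub>F k in sequentially. c < slope f (y k)"
      using less_LiminfD[OF c(2)] lim by (rule eventually_compose_filterlim)
    moreover have "\<forall>\<^sub>F k in sequentially. ereal (b k + \<delta> k) < c"
    proof (rule order_tendstoD(2)[of _ "ereal 0"])
      show "(\<lambda>k. ereal (b k + \<delta> k)) \<longlonglongrightarrow> ereal 0" using b\<delta> by (rule tendsto_ereal)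
      show "ereal 0 < c" using c(1) by (simp flip: zero_ereal_def)
    qed
    ultimately have "\<forall>\<^sub>F k in sequentially. False"
      by eventually_elim (use y(3) in \<open>meson less_trans less_irrefl\<close>)
    then show False by simp
  qed
  then have "limiting_slope f p \<le> 0" by (simp add: limiting_slope_def L)
  then show "critical_point f p"
    unfolding critical_point_def using limiting_slope_nonneg by (rule antisym)
qed

section \<open>Trapping by a length estimate\<close>

text \<open>The recursion is available only inside the ball, so the length bound and the containment
  go through one induction: the invariant at \<open>m\<close> puts \<open>u m\<close> in the ball,
  which licenses the next step.\<close>

lemma trapped_in_ball:
  fixes u :: "nat \<Rightarrow> 'a::metric_space" and d h :: "nat \<Rightarrow> real"
  assumes step: "\<And>k. dist (u k) p < r \<Longrightarrow> (d (Suc k))\<^sup>2 \<le> d k * (M * (h k - h (Suc k)))"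
    and u: "\<And>k. dist (u k) (u (Suc k)) \<le> d (Suc k)"
    and nonneg: "\<And>k. 0 \<le> d k" "\<And>k. 0 \<le> h k" "0 \<le> M" "\<And>k. h (Suc k) \<le> h k"
    and start: "dist (u 0) p + d 0 + M * h 0 < r"
  shows "dist (u m) p < r"
proof -
  define S where "S m = (\<Sum>k<m. d (Suc k))" for m
  have bound: "dist (u m) p < r" if "S m + d m + M * h m \<le> d 0 + M * h 0"
    "dist (u m) p \<le> dist (u 0) p + S m" for m
    using that start nonneg(1)[of m] mult_nonneg_nonneg[OF nonneg(3) nonneg(2)[of m]] by simp
  \<comment> \<open>The terms \<open>d m\<close> and \<open>M * h m\<close> absorb the two halves of the AM-GM bound on \<open>d (Suc m)\<close>.\<close>
  have "S m + d m + M * h m \<le> d 0 + M * h 0 \<and> dist (u m) p \<le> dist (u 0) p + S m"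
  proof (induction m)
    case (Suc m)
    define A where "A = M * (h m - h (Suc m))"
    have A: "0 \<le> A" using nonneg(3,4) by (simp add: A_def)
    have "(d (Suc m))\<^sup>2 \<le> d m * A" unfolding A_def using Suc bound by (intro step) blast
    also have "\<dots> \<le> ((d m + A) / 2)\<^sup>2"
      using zero_le_power2[of "d m - A"] by (simp add: power2_eq_square algebra_simps)
    finally have "d (Suc m) \<le> (d m + A) / 2"
      by (rule power2_le_imp_le) (simp add: A nonneg(1))
    moreover have "S (Suc m) = S m + d (Suc m)" by (simp add: S_def)
    ultimately show ?case
      using Suc dist_triangle[of "u (Suc m)" p "u m"] u[of m]
      by (simp add: A_def algebra_simps dist_commute)
  qed (simp add: S_def)
  then show ?thesis using bound by blast
qed

text \<open>A concave graph lies below its tangent at \<open>s\<close>. The point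
  \<open>t = 0\<close> is included because the value gap may reach 0 in one step.\<close>

lemma concave_le_tangent:
  fixes \<phi> :: "real \<Rightarrow> real"
  assumes "concave_on {0..} \<phi>" "(\<phi> has_real_derivative D) (at s)" "0 < s" "0 \<le> t"
  shows "D * (s - t) \<le> \<phi> s - \<phi> t"
proof -
  have "((\<lambda>x. - \<phi> x) has_real_derivative - D) (at s within {0..})"
    using assms(2) by (intro derivative_intros) (rule has_field_derivative_at_within)
  then have "- \<phi> t - (- \<phi> s) \<ge> - D * (t - s)"
    using assms by (intro convex_on_imp_above_tangent[of "{0..}"]) (auto simp: concave_on_def)
  then show ?thesis by (simp add: algebra_simps)
qed

section \<open>Convergence of the descent sequence\<close>

theorem theorem6p5:
  fixes f :: "'a::complete_space \<Rightarrow> ereal"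
    and x :: "nat \<Rightarrow> 'a"
    and \<alpha> \<beta> :: real
  assumes "KL_function f"
    and "fun_bounded_below f"
    and "continuous_on_slope_bounded f"
    and "0 < \<alpha>" and "0 < \<beta>"
    and "relatively_compact_seq x"
    and "\<And>k. f (x k) - f (x (Suc k)) \<ge> ereal (\<alpha> * (dist (x k) (x (Suc k)))\<^sup>2)"
    and "\<And>k. ereal (dist (x k) (x (Suc k))) \<ge> ereal \<beta> * limiting_slope f (x (Suc k))"
  shows "\<exists>xstar. x \<longlonglongrightarrow> xstar \<and> critical_point f xstar"
proof -
  \<comment> \<open>Shifted by one because \<open>f (x 0) = \<infinity>\<close> is possible.\<close>
  define u where "u k = x (Suc k)" for k
  \<comment> \<open>\<open>d k\<close> is the step arriving at \<open>u k\<close>, so it controls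
    the limiting slope at \<open>u k\<close>; the step leaving \<open>u k\<close> is
    \<open>d (Suc k)\<close>.\<close>
  define d where "d k = dist (x k) (x (Suc k))" for k
  obtain m where m: "\<And>z. ereal m \<le> f z" using assms(2) unfolding fun_bounded_below_def by blast
  \<comment> \<open>An infinite value would make the limiting slope infinite, yet
    \<open>\<beta>\<close> times it is at most a real distance; boundedness below excludes
    -\<infinity>.\<close>
  have "\<exists>g. f (u k) = ereal g" for k
  proof (cases "f (u k)")
    case PInf
    then have "limiting_slope f (u k) = \<infinity>" by (simp add: limiting_slope_def)
    then show ?thesis using assms(8)[of k] \<open>0 < \<beta>\<close> by (simp add: u_def)
  next
    case MInf
    then show ?thesis using m[of "u k"] by simp
  qed auto
  then obtain g where g: "\<And>k. f (u k) = ereal (g k)" by metis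
  have descent: "\<alpha> * (d (Suc k))\<^sup>2 \<le> g k - g (Suc k)" for k
    using assms(7)[of "Suc k"] g[of k] g[of "Suc k"] by (simp add: u_def d_def)
  have ls: "limiting_slope f (u k) \<le> ereal (d k / \<beta>)" for k
    using assms(8)[of k] \<open>0 < \<beta>\<close> limiting_slope_nonneg[of f "u k"]
    by (cases "limiting_slope f (u k)") (auto simp: u_def d_def field_simps)
  have d0: "0 \<le> d k" for k by (simp add: d_def)
  have gdec: "g (Suc k) \<le> g k" for k
  proof -
    have "0 \<le> \<alpha> * (d (Suc k))\<^sup>2" using \<open>0 < \<alpha>\<close> by simp
    then show ?thesis using descent[of k] by linarith
  qed
  have "decseq g" using gdec by (intro decseq_SucI)
  moreover have "m \<le> g k" for k using m[of "u k"] by (simp add: g)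
  ultimately obtain L where L: "g \<longlonglongrightarrow> L" "\<And>k. L \<le> g k" using decseq_convergent by metis
  have "(\<lambda>k. (d (Suc k))\<^sup>2) \<longlonglongrightarrow> 0"
  proof (rule tendsto_sandwich[OF _ _ tendsto_const])
    have "(\<lambda>k. (g k - g (Suc k)) / \<alpha>) \<longlonglongrightarrow> (L - L) / \<alpha>"
      using \<open>0 < \<alpha>\<close> by (intro tendsto_intros L(1) LIMSEQ_Suc) auto
    then show "(\<lambda>k. (g k - g (Suc k)) / \<alpha>) \<longlonglongrightarrow> 0" by simp
    show "\<forall>\<^sub>F k in sequentially. (d (Suc k))\<^sup>2 \<le> (g k - g (Suc k)) / \<alpha>"
      using descent \<open>0 < \<alpha>\<close> by (simp add: field_simps)
  qed simp
  from tendsto_real_sqrt[OF this] have "(\<lambda>k. d (Suc k)) \<longlonglongrightarrow> 0" using d0 by simp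
  then have dlim: "d \<longlonglongrightarrow> 0" by (rule LIMSEQ_imp_Suc)

  have "u k \<in> closure (range x)" for k
    using closure_subset[of "range x"] by (auto simp: u_def)
  moreover have "seq_compact (closure (range x))"
    using assms(6) unfolding relatively_compact_seq_def by (rule compact_imp_seq_compact)
  ultimately obtain p \<sigma> where \<sigma>: "strict_mono \<sigma>" "(u \<circ> \<sigma>) \<longlonglongrightarrow> p"
    unfolding seq_compact_def by metis
  have lsc: "lower_semicontinuous f" using assms(1) unfolding KL_function_def by blast
  have "(\<lambda>k. d (\<sigma> k) / \<beta>) \<longlonglongrightarrow> 0"
    using tendsto_divide[OF LIMSEQ_subseq_LIMSEQ[OF dlim \<sigma>(1)] tendsto_const[of \<beta>]] \<open>0 < \<beta>\<close>
    by (simp add: o_def)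
  note crit = critical_limit_point[OF lsc assms(3) \<sigma>(2), of "g \<circ> \<sigma>" L, OF _ _ _ this]
  have fp: "f p = ereal L" and cp: "critical_point f p"
    using crit g ls LIMSEQ_subseq_LIMSEQ[OF L(1) \<sigma>(1)] by auto

  have "\<bar>f p\<bar> \<noteq> \<infinity>" by (simp add: fp)
  from assms(1)[unfolded KL_function_def, THEN conjunct2, THEN conjunct2, rule_format, OF this]
  obtain \<phi> \<rho> where \<phi>: "desingularizer \<phi>" "concave_on {0..} \<phi>" "0 < \<rho>"
    and KL: "\<And>y. dist y p < \<rho> \<Longrightarrow> 0 < f y - ereal L \<Longrightarrow> f y - ereal L < ereal \<rho> \<Longrightarrow>
          1 \<le> slope (\<lambda>z. extend_desing \<phi> (f z - ereal L)) y"
    unfolding fp by auto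
  obtain \<phi>' where \<phi>': "continuous_on {0<..} \<phi>'"
    "\<And>t. t > 0 \<Longrightarrow> (\<phi> has_real_derivative \<phi>' t) (at t)" "\<And>t. t > 0 \<Longrightarrow> 0 < \<phi>' t"
    using \<phi>(1) unfolding desingularizer_def by blast
  define s where "s k = g k - L" for k
  define h where "h k = \<phi> (s k)" for k
  define M where "M = 1 / (\<alpha> * \<beta>)"
  have M0: "0 \<le> M" using \<open>0 < \<alpha>\<close> \<open>0 < \<beta>\<close> by (simp add: M_def)
  have s0: "0 \<le> s k" for k using L(2) by (simp add: s_def)
  have sdec: "s (Suc k) \<le> s k" for k using gdec by (simp add: s_def)
  have slim: "s \<longlonglongrightarrow> 0" unfolding s_def using tendsto_diff[OF L(1) tendsto_const[of L]] by simp
  have h0: "0 \<le> h k" for k using \<phi>(1) s0 unfolding desingularizer_def h_def by auto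
  have hdec: "h (Suc k) \<le> h k" for k
    unfolding h_def by (intro desingularizer_mono[OF \<phi>(1)] s0 sdec)
  have "continuous_on {0..} \<phi>" "\<phi> 0 = 0" using \<phi>(1) unfolding desingularizer_def by auto
  then have hlim: "h \<longlonglongrightarrow> 0"
    using continuous_on_tendsto_compose[of "{0..}" \<phi> s 0 sequentially] slim s0
    by (simp add: h_def[abs_def])
  have step: "(d (Suc k))\<^sup>2 \<le> d k * (M * (h k - h (Suc k)))"
    if k: "dist (u k) p < \<rho>" "s k < \<rho>" for k
  \<comment> \<open>The KL inequality needs a positive gap. With gap 0 the value has already reached
    its limit, and descent forces \<open>d (Suc k) = 0\<close>.\<close>
  proof (cases "s k = 0")
    case True
    then have "s (Suc k) = 0" using sdec[of k] s0[of "Suc k"] by simp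
    with True have "\<alpha> * (d (Suc k))\<^sup>2 \<le> 0" using descent[of k] by (simp add: s_def)
    then have "(d (Suc k))\<^sup>2 \<le> 0" using \<open>0 < \<alpha>\<close> by (simp add: mult_le_0_iff)
    also have "0 \<le> d k * (M * (h k - h (Suc k)))" using d0 M0 hdec by simp
    finally show ?thesis .
  next
    case False
    then have s: "0 < s k" using s0[of k] by simp
    have "1 \<le> \<phi>' (s k) * (d k / \<beta>)"
      using s k ls[of k] by (intro KL_limiting_slope[OF \<phi>(1) \<phi>'(1,2) KL]) (auto simp: g s_def)
    then have \<beta>: "\<beta> \<le> \<phi>' (s k) * d k" using \<open>0 < \<beta>\<close> by (simp add: field_simps)
    \<comment> \<open>The KL bound times the descent inequality; the tangent inequality then turns
      \<open>\<phi>' (s k) * (s k - s (Suc k))\<close> into the drop of \<open>h\<close>.\<close>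
    have "\<beta> * (\<alpha> * (d (Suc k))\<^sup>2) \<le> (\<phi>' (s k) * d k) * (s k - s (Suc k))"
      using \<open>0 < \<alpha>\<close> \<open>0 < \<beta>\<close> \<beta> descent[of k] by (intro mult_mono) (auto simp: s_def)
    also have "\<dots> = d k * (\<phi>' (s k) * (s k - s (Suc k)))" by simp
    also have "\<dots> \<le> d k * (h k - h (Suc k))"
      unfolding h_def using s s0 d0 by (intro mult_left_mono concave_le_tangent \<phi> \<phi>')
    finally show ?thesis using \<open>0 < \<alpha>\<close> \<open>0 < \<beta>\<close> by (simp add: M_def field_simps)
  qed
  have "u \<longlonglongrightarrow> p"
  proof (rule metric_LIMSEQ_I)
    fix e :: real assume "0 < e"
    \<comment> \<open>The ball of this radius lies in the KL neighbourhood of \<open>p\<close>, so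
      \<open>step\<close> is available for trapped iterates.\<close>
    define r where "r = min e \<rho>"
    have r: "0 < r" using \<open>0 < e\<close> \<phi>(3) by (simp add: r_def)
    define w where "w k = d k + M * h k" for k
    have "w \<longlonglongrightarrow> 0" unfolding w_def using tendsto_add[OF dlim tendsto_mult[OF tendsto_const[of M] hlim]] by simp
    then have "(\<lambda>k. w (\<sigma> k)) \<longlonglongrightarrow> 0" using \<sigma>(1) LIMSEQ_subseq_LIMSEQ by (force simp: o_def)
    moreover have "(\<lambda>k. dist (u (\<sigma> k)) p) \<longlonglongrightarrow> 0" using tendsto_dist_iff[THEN iffD1, OF \<sigma>(2)] by (simp add: o_def)
    ultimately have "(\<lambda>k. dist (u (\<sigma> k)) p + w (\<sigma> k)) \<longlonglongrightarrow> 0" using tendsto_add[of _ 0 _ _ 0] by simp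
    then have "\<forall>\<^sub>F k in sequentially. dist (u (\<sigma> k)) p + w (\<sigma> k) < r"
      using r by (rule order_tendstoD)
    moreover have "\<forall>\<^sub>F k in sequentially. s (\<sigma> k) < \<rho>"
      using order_tendstoD(2)[OF LIMSEQ_subseq_LIMSEQ[OF slim \<sigma>(1)] \<phi>(3)] by (simp add: o_def)
    ultimately have "\<forall>\<^sub>F k in sequentially. dist (u (\<sigma> k)) p + w (\<sigma> k) < r \<and> s (\<sigma> k) < \<rho>"
      by (rule eventually_conj)
    \<comment> \<open>Only a subsequence is known to approach \<open>p\<close>, so the starting
      index is taken among the \<open>\<sigma> k\<close>.\<close>
    then obtain n where n: "dist (u n) p + w n < r" "s n < \<rho>"
      using eventually_happens'[OF sequentially_bot] by blast
    \<comment> \<open>Gaps decrease, so the bound by \<open>\<rho>\<close> persists and only the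
      distance to \<open>p\<close> is left to control.\<close>
    have "s (n + k) < \<rho>" for k
      by (induction k) (use n(2) sdec in \<open>auto intro: le_less_trans\<close>)
    then have trapped_step: "(d (n + Suc k))\<^sup>2 \<le> d (n + k) * (M * (h (n + k) - h (n + Suc k)))"
      if "dist (u (n + k)) p < r" for k
      using step[of "n + k"] that by (simp add: r_def)
    have "dist (u (n + k)) p < r" for k
    proof (rule trapped_in_ball[where u = "\<lambda>k. u (n + k)" and d = "\<lambda>k. d (n + k)"
          and h = "\<lambda>k. h (n + k)" and M = M, OF trapped_step])
      show "dist (u (n + k)) (u (n + Suc k)) \<le> d (n + Suc k)" for k
        by (simp add: u_def d_def)
      show "dist (u (n + 0)) p + d (n + 0) + M * h (n + 0) < r"
        using n(1) by (simp add: w_def add.assoc)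
    qed (simp_all add: d0 h0 M0 hdec)
    then have "dist (u k) p < e" if "n \<le> k" for k
      using that le_Suc_ex[OF that] by (auto simp: r_def)
    then show "\<exists>no. \<forall>k\<ge>no. dist (u k) p < e" by blast
  qed
  then have "x \<longlonglongrightarrow> p" unfolding u_def by (rule LIMSEQ_imp_Suc)
  then show ?thesis using cp by blast
qed

end
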